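(* Let $(X,T)$ be a topological dynamical system and let $\mu$ be an ergodic $T$-invariant Borel probability measure on $X$. Then $(X,T)$ is $\mu$-mean equicontinuous if and only if it is $\mu$-logarithmically mean equicontinuous.
   Context: A topological dynamical system is a pair $(X,T)$ where $(X,d)$ is a compact metric space and $T\colon X\to X$ is a continuous map. Write $H_n=\sum_{k=1}^n\frac1k$. Let $\mu$ be a $T$-invariant Borel probability measure on $X$. $(X,T)$ is $\mu$-mean equicontinuous if for any $\eta\in(0,1)$ there exists a Borel set $X_\eta\subset X$ with $\mu(X_\eta)>\eta$ such that for any $\varepsilon>0$ there exists $\delta>0$ such that for any $x,y\in X_\eta$ with $d(x,y)<\delta$, $$\limsup_{n\to\infty}\frac1n\sum_{k=1}^n d(T^{k-1}x,T^{k-1}y)<\varepsilon.$$ $(X,T)$ is $\mu$-logarithmically mean equicontinuous if for any $\eta\in(0,1)$ there exists a Borel set $X_\eta\subset X$ with $\mu(X_\eta)>\eta$ such that for any $\varepsilon>0$ there exists $\delta>0$ such that for any $x,y\in X_\eta$ with $d(x,y)<\delta$, $$\limsup_{n\to\infty}\frac1{H_n}\sum_{k=1}^n\frac1k\, d(T^{k-1}x,T^{k-1}y)<\varepsilon.$$ *)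

theory Defs
  imports "HOL-Probability.Probability"
begin

definition topological_dynamical_system :: "'a::metric_space set \<Rightarrow> ('a \<Rightarrow> 'a) \<Rightarrow> bool" where
  "topological_dynamical_system X T \<longleftrightarrow> compact X \<and> continuous_on X T \<and> T \<in> X \<rightarrow> X"

text \<open>Measures on X live on the Borel sigma-algebra of the subspace X of the ambient type,
  so \<open>space \<mu> = X\<close> and preimages under T are taken within X.\<close>

definition invariant_borel_probability ::
    "'a::metric_space set \<Rightarrow> ('a \<Rightarrow> 'a) \<Rightarrow> 'a measure \<Rightarrow> bool" where
  "invariant_borel_probability X T \<mu> \<longleftrightarrow>
     prob_space \<mu> \<and> sets \<mu> = sets (restrict_space borel X) \<and>
     (\<forall>A\<in>sets \<mu>. emeasure \<mu> (T -` A \<inter> X) = emeasure \<mu> A)"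

definition ergodic_borel_probability ::
    "'a::metric_space set \<Rightarrow> ('a \<Rightarrow> 'a) \<Rightarrow> 'a measure \<Rightarrow> bool" where
  "ergodic_borel_probability X T \<mu> \<longleftrightarrow>
     invariant_borel_probability X T \<mu> \<and>
     (\<forall>A\<in>sets \<mu>. T -` A \<inter> X = A \<longrightarrow> emeasure \<mu> A = 0 \<or> emeasure \<mu> A = 1)"

text \<open>The upper limits are taken in the extended reals; as X is compact, the averages are
  bounded and the values are the usual real ones. The term for \<open>n = 0\<close> does not matter.\<close>

definition mean_orbit_dist :: "('a::metric_space \<Rightarrow> 'a) \<Rightarrow> 'a \<Rightarrow> 'a \<Rightarrow> ereal" where
  "mean_orbit_dist T x y =
     limsup (\<lambda>n. ereal (1 / real n * (\<Sum>k=1..n. dist ((T ^^ (k - 1)) x) ((T ^^ (k - 1)) y))))"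

definition log_mean_orbit_dist :: "('a::metric_space \<Rightarrow> 'a) \<Rightarrow> 'a \<Rightarrow> 'a \<Rightarrow> ereal" where
  "log_mean_orbit_dist T x y =
     limsup (\<lambda>n. ereal (1 / harm n *
       (\<Sum>k=1..n. 1 / real k * dist ((T ^^ (k - 1)) x) ((T ^^ (k - 1)) y))))"

definition mean_equicontinuous_wrt :: "'a::metric_space measure \<Rightarrow> ('a \<Rightarrow> 'a) \<Rightarrow> bool" where
  "mean_equicontinuous_wrt \<mu> T \<longleftrightarrow>
     (\<forall>\<eta>\<in>{0<..<1::real}. \<exists>Y\<in>sets \<mu>. measure \<mu> Y > \<eta> \<and>
       (\<forall>\<epsilon>>0::real. \<exists>\<delta>>0. \<forall>x\<in>Y. \<forall>y\<in>Y. dist x y < \<delta> \<longrightarrow> mean_orbit_dist T x y < ereal \<epsilon>))"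

definition log_mean_equicontinuous_wrt :: "'a::metric_space measure \<Rightarrow> ('a \<Rightarrow> 'a) \<Rightarrow> bool" where
  "log_mean_equicontinuous_wrt \<mu> T \<longleftrightarrow>
     (\<forall>\<eta>\<in>{0<..<1::real}. \<exists>Y\<in>sets \<mu>. measure \<mu> Y > \<eta> \<and>
       (\<forall>\<epsilon>>0::real. \<exists>\<delta>>0. \<forall>x\<in>Y. \<forall>y\<in>Y. dist x y < \<delta> \<longrightarrow> log_mean_orbit_dist T x y < ereal \<epsilon>))"

end

theory Submission
  imports Defs
begin

text \<open>Abel summation bounds logarithmic averages by ordinary ones, which gives one direction.
  Conversely, let a bounded function on a measure preserving system have upper Cesaro averages
  above \<open>b\<close> and upper logarithmic averages below \<open>a < b\<close> on an invariant set \<open>E\<close>. The maximal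
  ergodic theorem shows that its integral over \<open>E\<close> is at least \<open>b\<close> times the measure of \<open>E\<close>, while
  integrating the logarithmic averages shows that it is at most \<open>a\<close> times the measure of \<open>E\<close>; so
  \<open>E\<close> is null. Applied to the distance function on the product system, the two mean orbit
  pseudometrics agree at almost every pair. Two close points \<open>x\<close>, \<open>y\<close> of a set of logarithmic mean
  equicontinuity, both outside a null set, are then compared through a third point \<open>z\<close> of the set,
  which is close to both and such that the pairs \<open>(x, z)\<close> and \<open>(y, z)\<close> are generic.\<close>

section \<open>Cesaro and logarithmic means of real sequences\<close>

text \<open>Sums start at 1 and read \<open>c (k - 1)\<close>, so orbit sequences fit the mean orbit
  distances literally. The value at \<open>n = 0\<close> is 0 by division by zero.\<close>

definition cesaro_mean :: "(nat \<Rightarrow> real) \<Rightarrow> nat \<Rightarrow> real" where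
  "cesaro_mean c n = 1 / real n * (\<Sum>k=1..n. c (k - 1))"

definition log_mean :: "(nat \<Rightarrow> real) \<Rightarrow> nat \<Rightarrow> real" where
  "log_mean c n = 1 / harm n * (\<Sum>k=1..n. 1 / real k * c (k - 1))"

lemma tendsto_div_harm: "(\<lambda>n. K / harm n :: real) \<longlonglongrightarrow> 0"
  by (intro tendsto_divide_0[OF tendsto_const] filterlim_at_top_imp_at_infinity harm_at_top)

text \<open>Write \<open>u\<close> as \<open>(u - v) + v\<close>: adding a sequence with a finite
  limit shifts an upper limit by that limit.\<close>

lemma limsup_ereal_eqI:
  fixes u v :: "nat \<Rightarrow> real"
  assumes "(\<lambda>n. u n - v n) \<longlonglongrightarrow> 0"
  shows "limsup (\<lambda>n. ereal (u n)) = limsup (\<lambda>n. ereal (v n))"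
proof -
  have "limsup (\<lambda>n. ereal (u n - v n) + ereal (v n)) = 0 + limsup (\<lambda>n. ereal (v n))"
    by (rule ereal_limsup_lim_add) (use assms in \<open>auto simp: zero_ereal_def\<close>)
  then show ?thesis by simp
qed

section \<open>Shift invariance of the upper means of bounded sequences\<close>

lemma limsup_cesaro_mean_Suc:
  assumes "\<And>k. \<bar>c k\<bar> \<le> B"
  shows "limsup (\<lambda>n. ereal (cesaro_mean (\<lambda>k. c (Suc k)) n)) = limsup (\<lambda>n. ereal (cesaro_mean c n))"
proof (rule limsup_ereal_eqI)
  have "(\<Sum>k=1..n. c (Suc (k - 1))) - (\<Sum>k=1..n. c (k - 1)) = c n - c 0" for n
    by (induction n) auto
  then have eq: "cesaro_mean (\<lambda>k. c (Suc k)) n - cesaro_mean c n = (c n - c 0) / real n" for n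
    unfolding cesaro_mean_def right_diff_distrib[symmetric] by (simp only: divide_inverse mult_1 mult.commute)
  have "\<bar>c n - c 0\<bar> \<le> 2 * B" for n
    using assms[of n] assms[of 0] by linarith
  then have "norm (cesaro_mean (\<lambda>k. c (Suc k)) n - cesaro_mean c n) \<le> 2 * B / real n" for n
    unfolding eq by (simp add: divide_right_mono)
  then show "(\<lambda>n. cesaro_mean (\<lambda>k. c (Suc k)) n - cesaro_mean c n) \<longlonglongrightarrow> 0"
    by (intro Lim_null_comparison[OF _ lim_const_over_n[of "2 * B"]] always_eventually allI)
qed

lemma limsup_log_mean_Suc:
  assumes B: "\<And>k. \<bar>c k\<bar> \<le> B"
  shows "limsup (\<lambda>n. ereal (log_mean (\<lambda>k. c (Suc k)) n)) = limsup (\<lambda>n. ereal (log_mean c n))"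
proof (rule limsup_ereal_eqI)
  define P where "P n = (\<Sum>k=1..n. 1 / real k * (c (Suc (k - 1)) - c (k - 1)))" for n
  \<comment> \<open>Abel summation: once the boundary term is subtracted, the increments are
    \<open>c (Suc n)\<close> times \<open>1 / (n + 1) - 1 / (n + 2)\<close>. The bound is
    \<open>B\<close> for the initial value \<open>- c 0\<close> plus the telescoped weights
    \<open>1 - 1 / (n + 1)\<close> times \<open>B\<close>.\<close>
  have "\<bar>P n - c n / real (n + 1)\<bar> \<le> B * (2 - 1 / real (n + 1))" for n
  proof (induction n)
    case 0
    then show ?case using B[of 0] by (simp add: P_def)
  next
    case (Suc n)
    have nonneg: "0 \<le> 1 / real (n + 1) - 1 / real (n + 2)"
      by (simp add: field_simps)
    have "P (Suc n) - c (Suc n) / real (Suc n + 1)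
      = (P n - c n / real (n + 1)) + c (Suc n) * (1 / real (n + 1) - 1 / real (n + 2))"
      by (simp add: P_def algebra_simps diff_divide_distrib)
    moreover have "\<bar>c (Suc n) * (1 / real (n + 1) - 1 / real (n + 2))\<bar>
        \<le> B * (1 / real (n + 1) - 1 / real (n + 2))"
      unfolding abs_mult abs_of_nonneg[OF nonneg] by (intro mult_right_mono B nonneg)
    moreover have "B * (2 - 1 / real (Suc n + 1))
      = B * (2 - 1 / real (n + 1)) + B * (1 / real (n + 1) - 1 / real (n + 2))"
      by (simp add: algebra_simps)
    ultimately show ?case using Suc by linarith
  qed
  moreover have "\<bar>c n / real (n + 1)\<bar> \<le> B / real (n + 1)" for n
    using B[of n] by (simp add: divide_right_mono)
  ultimately have "\<bar>P n\<bar> \<le> B * (2 - 1 / real (n + 1)) + B / real (n + 1)" for n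
    by (smt (verit))
  then have P: "\<bar>P n\<bar> \<le> 2 * B" for n
    by (simp add: algebra_simps)
  have eq: "log_mean (\<lambda>k. c (Suc k)) n - log_mean c n = P n / harm n" for n
    unfolding log_mean_def P_def
    by (simp add: sum_subtractf right_diff_distrib diff_divide_distrib)
  have "norm (log_mean (\<lambda>k. c (Suc k)) n - log_mean c n) \<le> 2 * B / harm n" for n
    unfolding eq using P[of n] by (simp add: divide_right_mono harm_nonneg)
  then show "(\<lambda>n. log_mean (\<lambda>k. c (Suc k)) n - log_mean c n) \<longlonglongrightarrow> 0"
    by (intro Lim_null_comparison[OF _ tendsto_div_harm[of "2 * B"]] always_eventually allI)
qed

lemma log_mean_bounds:
  assumes "\<And>k. \<bar>c k\<bar> \<le> B"
  shows "\<bar>log_mean c n\<bar> \<le> B"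
proof -
  have B0: "0 \<le> B" using assms[of 0] by linarith
  have "\<bar>\<Sum>k=1..n. 1 / real k * c (k - 1)\<bar> \<le> (\<Sum>k=1..n. 1 / real k * B)"
    using assms by (intro order.trans[OF sum_abs] sum_mono) (simp add: abs_mult divide_right_mono)
  also have "\<dots> = harm n * B"
    by (simp add: harm_def sum_distrib_right inverse_eq_divide)
  finally have "\<bar>log_mean c n\<bar> \<le> 1 / harm n * (harm n * B)"
    unfolding log_mean_def abs_mult by (intro mult_mono) (simp_all add: harm_nonneg)
  \<comment> \<open>Here \<open>0 \<le> B\<close> covers \<open>n = 0\<close>, where
    \<open>harm 0 = 0\<close> makes the left side vanish.\<close>
  also have "\<dots> \<le> B" using B0 by simp
  finally show ?thesis .
qed

text \<open>For a real \<open>a\<close> above the upper Cesaro mean, the partial sums of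
  \<open>c - a\<close> are eventually nonpositive, hence bounded above. Abel summation against the
  decreasing weights \<open>1 / k\<close> preserves the bound, which disappears after division by
  \<open>harm n\<close>.\<close>

lemma limsup_log_mean_le_limsup_cesaro_mean:
  "limsup (\<lambda>n. ereal (log_mean c n)) \<le> limsup (\<lambda>n. ereal (cesaro_mean c n))"
proof (rule dense_ge)
  fix t assume t: "limsup (\<lambda>n. ereal (cesaro_mean c n)) < t"
  show "limsup (\<lambda>n. ereal (log_mean c n)) \<le> t"
  proof (cases t)
    case (real a)
    define R where "R n = (\<Sum>k=1..n. c (k - 1) - a)" for n
    have "\<forall>\<^sub>F n in sequentially. ereal (cesaro_mean c n) < t"
      using t by (rule Limsup_lessD)
    then obtain N where N: "\<And>n. n \<ge> N \<Longrightarrow> cesaro_mean c n < a"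
      using real by (auto simp: eventually_sequentially)
    \<comment> \<open>The finite maximum handles \<open>n \<le> N\<close>; the inserted 0 handles
      the rest, where \<open>R n \<le> 0\<close>.\<close>
    define K where "K = Max (insert 0 (R ` {..N}))"
    have K: "R n \<le> K" for n
    proof (cases "n \<le> N")
      case True
      then show ?thesis unfolding K_def by (intro Max_ge) auto
    next
      case False
      then have "R n \<le> 0"
        using N[of n] by (simp add: R_def cesaro_mean_def sum_subtractf field_simps)
      also have "0 \<le> K" by (simp add: K_def)
      finally show ?thesis .
    qed
    \<comment> \<open>The boundary term stays exact so that the induction closes; only the earlier
      partial sums are replaced by \<open>K\<close>, with telescoping total weight
      \<open>1 - 1 / (n + 1)\<close>.\<close>
    have W: "(\<Sum>k=1..n. 1 / real k * (c (k - 1) - a))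
      \<le> R n / real (n + 1) + K * (1 - 1 / real (n + 1))" for n
    proof (induction n)
      case 0
      then show ?case by (simp add: R_def)
    next
      case (Suc n)
      have "R (Suc n) * (1 / real (n + 1) - 1 / real (n + 2))
          \<le> K * (1 / real (n + 1) - 1 / real (n + 2))"
        by (intro mult_right_mono K) (simp add: field_simps)
      moreover have "R n / real (n + 1) + (c n - a) / real (n + 1) = R (Suc n) / real (n + 1)"
        by (simp add: R_def add_divide_distrib[symmetric])
      ultimately show ?case using Suc by (simp add: algebra_simps diff_divide_distrib)
    qed
    have "(\<Sum>k=1..n. 1 / real k * (c (k - 1) - a)) \<le> K" for n
    proof -
      have "R n / real (n + 1) \<le> K / real (n + 1)"
        by (intro divide_right_mono K) simp
      then show ?thesis using W[of n] by (simp add: algebra_simps)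
    qed
    then have "(\<Sum>k=1..n. 1 / real k * c (k - 1)) \<le> a * harm n + K" for n
      by (simp add: harm_def sum_subtractf sum_distrib_left inverse_eq_divide algebra_simps
          diff_divide_distrib)
    then have "log_mean c n \<le> 1 / harm n * (a * harm n + K)" for n
      unfolding log_mean_def by (intro mult_left_mono) (simp_all add: harm_nonneg)
    moreover have "1 / harm n * (a * harm n + K) = a + K / harm n" if "n > 0" for n
      using less_imp_neq[OF harm_pos[OF that, where ?'a=real]]
      by (simp add: add_divide_distrib distrib_left)
    ultimately have "\<forall>\<^sub>F n in sequentially. ereal (log_mean c n) \<le> ereal (a + K / harm n)"
      by (intro eventually_mono[OF eventually_gt_at_top[of 0]]) (metis ereal_less_eq(3))
    then have "limsup (\<lambda>n. ereal (log_mean c n)) \<le> limsup (\<lambda>n. ereal (a + K / harm n))"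
      by (rule Limsup_mono)
    also have "\<dots> = ereal a"
      by (rule lim_imp_Limsup)
        (use tendsto_add[OF tendsto_const[of a] tendsto_div_harm[of K]] in auto)
    finally show ?thesis using real by simp
  qed (use t in auto)
qed

lemma limsup_cesaro_mean_le_add:
  assumes "limsup (\<lambda>n. ereal (cesaro_mean b n)) < ereal \<epsilon>"
    and "limsup (\<lambda>n. ereal (cesaro_mean c n)) < ereal \<epsilon>'"
    and "\<And>k. a k \<le> b k + c k"
  shows "limsup (\<lambda>n. ereal (cesaro_mean a n)) \<le> ereal (\<epsilon> + \<epsilon>')"
proof (rule Limsup_bounded)
  have le: "cesaro_mean a n \<le> cesaro_mean b n + cesaro_mean c n" for n
    unfolding cesaro_mean_def distrib_left[symmetric] sum.distrib[symmetric]
    by (intro mult_left_mono sum_mono assms) simp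
  show "\<forall>\<^sub>F n in sequentially. ereal (cesaro_mean a n) \<le> ereal (\<epsilon> + \<epsilon>')"
    using Limsup_lessD[OF assms(1)] Limsup_lessD[OF assms(2)]
  proof eventually_elim
    case (elim n)
    then show ?case using le[of n] by simp
  qed
qed

section \<open>Almost everywhere comparison in measure preserving systems\<close>

text \<open>This is the maximum of 0 and the first \<open>n\<close> Birkhoff sums. The recursion
  along \<open>T\<close> makes Garsia's inequality immediate.\<close>

primrec max_birkhoff_sum :: "('a \<Rightarrow> 'a) \<Rightarrow> ('a \<Rightarrow> real) \<Rightarrow> nat \<Rightarrow> 'a \<Rightarrow> real" where
  "max_birkhoff_sum T f 0 x = 0"
| "max_birkhoff_sum T f (Suc n) x = max 0 (f x + max_birkhoff_sum T f n (T x))"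

lemma max_birkhoff_sum_nonneg: "0 \<le> max_birkhoff_sum T f n x"
  by (cases n) auto

lemma max_birkhoff_sum_Suc_ge: "max_birkhoff_sum T f n x \<le> max_birkhoff_sum T f (Suc n) x"
proof (induction n arbitrary: x)
  case (Suc n)
  from Suc[of "T x"] show ?case by (auto simp: max_def)
qed simp

lemma max_birkhoff_sum_mono: "m \<le> n \<Longrightarrow> max_birkhoff_sum T f m x \<le> max_birkhoff_sum T f n x"
  by (rule lift_Suc_mono_le[of "\<lambda>n. max_birkhoff_sum T f n x"]) (rule max_birkhoff_sum_Suc_ge)

lemma birkhoff_sum_le_max: "(\<Sum>k<n. f ((T ^^ k) x)) \<le> max_birkhoff_sum T f n x"
proof (induction n arbitrary: x)
  case (Suc n)
  have "(\<Sum>k<Suc n. f ((T ^^ k) x)) = f x + (\<Sum>k<n. f ((T ^^ k) (T x)))"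
    by (subst sum.lessThan_Suc_shift) (simp add: funpow_Suc_right del: funpow.simps)
  then show ?case using Suc[of "T x"] by simp
qed simp

text \<open>Invariance is stated as equality with the image measure, so that the change of variables
  rules for \<open>distr\<close> apply. The locale is later interpreted for the product
  system.\<close>

locale measure_preserving = prob_space M for M :: "'a measure" +
  fixes T :: "'a \<Rightarrow> 'a"
  assumes T_measurable [measurable]: "T \<in> measurable M M"
    and distr_T: "distr M M T = M"
begin

lemma funpow_measurable [measurable]: "T ^^ k \<in> measurable M M"
  by (induction k) auto

lemma integrable_compose:
  fixes f :: "'a \<Rightarrow> real"
  assumes "integrable M f" shows "integrable M (\<lambda>x. f (T x))"
  using assms by (subst (asm) distr_T[symmetric]) (erule integrable_distr[OF T_measurable])

lemma integral_compose:
  fixes f :: "'a \<Rightarrow> real"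
  assumes [measurable]: "f \<in> borel_measurable M"
  shows "(\<integral>x. f (T x) \<partial>M) = (\<integral>x. f x \<partial>M)"
  by (subst (2) distr_T[symmetric]) (simp add: integral_distr)

lemma integral_compose_funpow:
  fixes f :: "'a \<Rightarrow> real"
  assumes [measurable]: "f \<in> borel_measurable M"
  shows "(\<integral>x. f ((T ^^ k) x) \<partial>M) = (\<integral>x. f x \<partial>M)"
proof (induction k)
  case (Suc k)
  have "(\<integral>x. f ((T ^^ k) (T x)) \<partial>M) = (\<integral>x. f ((T ^^ k) x) \<partial>M)"
    by (rule integral_compose) measurable
  with Suc show ?case by (simp add: funpow_Suc_right del: funpow.simps)
qed simp

lemma integrable_max_birkhoff_sum:
  assumes "integrable M f" shows "integrable M (max_birkhoff_sum T f n)"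
proof (induction n)
  case (Suc n)
  then show ?case
    using assms by (auto intro!: integrable_max integrable_compose Bochner_Integration.integrable_add)
qed simp

text \<open>Garsia's argument: where it is positive, \<open>max_birkhoff_sum T f n\<close> is at most
  \<open>f + max_birkhoff_sum T f n \<circ> T\<close>.\<close>

lemma maximal_ergodic:
  assumes f: "integrable M f"
  shows "0 \<le> (\<integral>x. indicator {x. 0 < max_birkhoff_sum T f n x} x * f x \<partial>M)"
proof -
  let ?F = "max_birkhoff_sum T f n"
  note F = integrable_max_birkhoff_sum[OF f, of n]
  note [measurable] = borel_measurable_integrable[OF F] borel_measurable_integrable[OF f]
  have "0 = (\<integral>x. ?F x - ?F (T x) \<partial>M)"
    using F integrable_compose[OF F] by (simp add: integral_compose)
  also have "\<dots> \<le> (\<integral>x. indicator {x. 0 < ?F x} x * f x \<partial>M)"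
  proof (rule integral_mono)
    show "integrable M (\<lambda>x. ?F x - ?F (T x))"
      using F integrable_compose[OF F] by simp
    show "integrable M (\<lambda>x. indicator {x. 0 < ?F x} x * f x)"
      by (rule Bochner_Integration.integrable_bound[OF f]) (auto simp: indicator_def)
    fix x
    have le: "?F x \<le> f x + ?F (T x)" if "0 < ?F x"
    proof (cases n)
      case (Suc m)
      with that have "?F x = f x + max_birkhoff_sum T f m (T x)"
        by (auto simp: max_def split: if_splits)
      also have "\<dots> \<le> f x + ?F (T x)"
        using max_birkhoff_sum_Suc_ge[of T f m "T x"] Suc by simp
      finally show ?thesis .
    qed (use that in simp)
    \<comment> \<open>Where \<open>?F x\<close> is 0, the left side is
      \<open>- ?F (T x) \<le> 0\<close> and the right side is 0.\<close>
    show "?F x - ?F (T x) \<le> indicator {x. 0 < ?F x} x * f x"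
      using le max_birkhoff_sum_nonneg[of T f n x] max_birkhoff_sum_nonneg[of T f n "T x"]
      by (cases "0 < ?F x") auto
  qed
  finally show ?thesis .
qed

text \<open>The sets where \<open>max_birkhoff_sum T f n\<close> is positive increase with
  \<open>n\<close> and eventually contain each point with \<open>f x \<noteq> 0\<close>. Dominated
  convergence then carries \<open>maximal_ergodic\<close> over to the whole integral.\<close>

lemma integral_nonneg_if_birkhoff_sum_pos:
  fixes f :: "'a \<Rightarrow> real"
  assumes f: "integrable M f"
    and pos: "\<And>x. x \<in> space M \<Longrightarrow> f x \<noteq> 0 \<Longrightarrow> \<exists>n. 0 < (\<Sum>k<n. f ((T ^^ k) x))"
  shows "0 \<le> (\<integral>x. f x \<partial>M)"
proof -
  let ?F = "max_birkhoff_sum T f"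
  have [measurable]: "?F n \<in> borel_measurable M" "f \<in> borel_measurable M" for n
    using integrable_max_birkhoff_sum[OF f] f by blast+
  have "(\<lambda>n. \<integral>x. indicator {x. 0 < ?F n x} x * f x \<partial>M) \<longlonglongrightarrow> (\<integral>x. f x \<partial>M)"
  proof (rule integral_dominated_convergence[where w = "\<lambda>x. \<bar>f x\<bar>"])
    show "AE x in M. (\<lambda>n. indicator {x. 0 < ?F n x} x * f x) \<longlonglongrightarrow> f x"
    proof (rule AE_I2)
      fix x assume x: "x \<in> space M"
      show "(\<lambda>n. indicator {x. 0 < ?F n x} x * f x) \<longlonglongrightarrow> f x"
      proof (cases "f x = 0")
        case False
        then obtain m where "0 < (\<Sum>k<m. f ((T ^^ k) x))" using pos x by blast
        then have "0 < ?F m x" using birkhoff_sum_le_max[of f T x m] by linarith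
        then have "0 < ?F n x" if "n \<ge> m" for n
          using max_birkhoff_sum_mono[OF that, of T f x] by linarith
        then show ?thesis
          by (intro tendsto_eventually eventually_sequentiallyI[of m]) auto
      qed simp
    qed
  qed (use f in \<open>auto simp: indicator_def\<close>)
  then show ?thesis
    by (rule LIMSEQ_le_const) (use maximal_ergodic[OF f] in auto)
qed

section \<open>Comparison of upper Cesaro and upper logarithmic means\<close>

lemma funpow_space: "x \<in> space M \<Longrightarrow> (T ^^ k) x \<in> space M"
  using measurable_space[OF funpow_measurable] .

text \<open>The integral \<open>m\<close> of \<open>f\<close> over \<open>E\<close> satisfies
  \<open>b * prob E \<le> m \<le> a * prob E\<close>, which forces \<open>prob E = 0\<close> as
  \<open>a < b\<close>.\<close>

lemma null_upper_log_mean_less: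
  fixes f :: "'a \<Rightarrow> real"
  assumes [measurable]: "f \<in> borel_measurable M"
    and B: "\<And>x. x \<in> space M \<Longrightarrow> \<bar>f x\<bar> \<le> B"
    and ab: "a < b"
  defines "E \<equiv> {x \<in> space M. limsup (\<lambda>n. ereal (log_mean (\<lambda>k. f ((T ^^ k) x)) n)) < ereal a
     \<and> ereal b < limsup (\<lambda>n. ereal (cesaro_mean (\<lambda>k. f ((T ^^ k) x)) n))}"
  shows "E \<in> null_sets M"
proof -
  let ?c = "\<lambda>x k. f ((T ^^ k) x)"
  have [measurable]: "(\<lambda>x. log_mean (?c x) n) \<in> borel_measurable M"
    "(\<lambda>x. cesaro_mean (?c x) n) \<in> borel_measurable M" for n
    unfolding log_mean_def cesaro_mean_def by measurable
  have E [measurable]: "E \<in> sets M" unfolding E_def by measurable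
  have orbit: "\<bar>?c x k\<bar> \<le> B" if "x \<in> space M" for x k
    using B funpow_space[OF that] by blast
  \<comment> \<open>Both upper means are unchanged by a shift of the orbit, so \<open>E\<close> is
    invariant and its indicator is constant along orbits.\<close>
  have invariant: "T x \<in> E \<longleftrightarrow> x \<in> E" if x: "x \<in> space M" for x
  proof -
    have shift: "?c (T x) = (\<lambda>k. ?c x (Suc k))"
      by (simp add: funpow_swap1)
    show ?thesis
      using x measurable_space[OF T_measurable x] limsup_cesaro_mean_Suc[of "?c x", OF orbit[OF x]]
        limsup_log_mean_Suc[of "?c x", OF orbit[OF x]]
      unfolding E_def mem_Collect_eq shift by (simp del: funpow.simps)
  qed
  have invariant': "(T ^^ k) x \<in> E \<longleftrightarrow> x \<in> E" if "x \<in> space M" for k x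
    using that by (induction k) (auto simp: invariant funpow_space)
  have indE: "indicator E ((T ^^ k) x) = (indicator E x :: real)" if "x \<in> space M" for k x
    using invariant'[OF that] by (auto simp: indicator_def)
  define m where "m = (\<integral>x. indicator E x * f x \<partial>M)"
  have bounded_integrable: "integrable M (\<lambda>x. indicator E x * h x)"
    if [measurable]: "h \<in> borel_measurable M" and "\<And>x. x \<in> space M \<Longrightarrow> \<bar>h x\<bar> \<le> C"
    for h :: "'a \<Rightarrow> real" and C
    using that(2) by (intro integrable_const_bound[of _ C] AE_I2)
      (force simp: indicator_def intro: order.trans[OF abs_ge_zero])+
  have "0 \<le> (\<integral>x. indicator E x * (f x - b) \<partial>M)"
  proof (rule integral_nonneg_if_birkhoff_sum_pos)
    show "integrable M (\<lambda>x. indicator E x * (f x - b))"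
    proof (rule bounded_integrable)
      show "\<bar>f x - b\<bar> \<le> B + \<bar>b\<bar>" if "x \<in> space M" for x
        using B[OF that] by linarith
    qed simp
    fix x assume x: "x \<in> space M" and "indicator E x * (f x - b) \<noteq> 0"
    then have xE: "x \<in> E" by (auto simp: indicator_def split: if_splits)
    \<comment> \<open>A Cesaro mean above \<open>b\<close> at a positive \<open>n\<close> is a
      positive Birkhoff sum of \<open>f - b\<close>, and by invariance also of its restriction to
      \<open>E\<close>.\<close>
    have "\<exists>n>0. b < cesaro_mean (?c x) n"
    proof (rule ccontr)
      assume "\<not> ?thesis"
      then have "cesaro_mean (?c x) n \<le> b" if "n > 0" for n
        using that not_less by blast
      then have "limsup (\<lambda>n. ereal (cesaro_mean (?c x) n)) \<le> ereal b"
        by (intro Limsup_bounded eventually_mono[OF eventually_gt_at_top[of 0]]) simp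
      moreover have "ereal b < limsup (\<lambda>n. ereal (cesaro_mean (?c x) n))"
        using xE by (simp add: E_def)
      ultimately show False by (meson leD)
    qed
    then obtain n where n: "n > 0" "b < cesaro_mean (?c x) n" by blast
    have "(\<Sum>k=1..n. ?c x (k - 1)) = (\<Sum>k<n. ?c x k)"
      by (induction n) auto
    then have "0 < (\<Sum>k<n. ?c x k - b)"
      using n by (simp add: cesaro_mean_def sum_subtractf field_simps)
    then have "0 < (\<Sum>k<n. indicator E ((T ^^ k) x) * (?c x k - b))"
      using xE x by (simp add: indE)
    then show "\<exists>n. 0 < (\<Sum>k<n. indicator E ((T ^^ k) x) * (?c x k - b))" ..
  qed
  also have "\<dots> = m - b * prob E"
  proof -
    have "integrable M (\<lambda>x. indicator E x * f x)" "integrable M (\<lambda>x. indicator E x * b)"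
      by (rule bounded_integrable, simp, erule B) (rule bounded_integrable, simp, rule order.refl)
    then show ?thesis by (simp add: m_def right_diff_distrib)
  qed
  finally have lower: "b * prob E \<le> m" by simp
  have upper: "m \<le> a * prob E"
  proof -
    \<comment> \<open>Truncation from below at \<open>a\<close> turns an upper limit below
      \<open>a\<close> into convergence: on \<open>E\<close> the truncated means are eventually
      equal to \<open>a\<close>.\<close>
    let ?g = "\<lambda>n x. indicator E x * max a (log_mean (?c x) n)"
    have log_bound: "\<bar>log_mean (?c x) n\<bar> \<le> B" if "x \<in> space M" for x n
      by (rule log_mean_bounds) (rule orbit[OF that])
    have "(\<lambda>n. \<integral>x. ?g n x \<partial>M) \<longlonglongrightarrow> (\<integral>x. indicator E x * a \<partial>M)"
    proof (rule integral_dominated_convergence[where w = "\<lambda>x. \<bar>a\<bar> + B"])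
      show "AE x in M. (\<lambda>n. ?g n x) \<longlonglongrightarrow> indicator E x * a"
      proof (rule AE_I2)
        fix x
        show "(\<lambda>n. ?g n x) \<longlonglongrightarrow> indicator E x * a"
        proof (cases "x \<in> E")
          case True
          then have "limsup (\<lambda>n. ereal (log_mean (?c x) n)) < ereal a" by (simp add: E_def)
          then have "\<forall>\<^sub>F n in sequentially. ereal (log_mean (?c x) n) < ereal a"
            by (rule Limsup_lessD)
          then show ?thesis
            by (intro tendsto_eventually, elim eventually_mono) (simp add: max_def)
        qed simp
      qed
      fix n
      show "AE x in M. norm (?g n x) \<le> \<bar>a\<bar> + B"
        by (rule AE_I2) (use log_bound[of _ n] in \<open>force simp: indicator_def\<close>)
    qed simp_all
    then have lim: "(\<lambda>n. \<integral>x. ?g n x \<partial>M) \<longlonglongrightarrow> a * prob E" by (simp add: mult.commute)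
    \<comment> \<open>Every \<open>f \<circ> T ^^ k\<close> has integral \<open>m\<close> over
      \<open>E\<close>, and the logarithmic weights sum to 1 when \<open>n > 0\<close>; so the
      logarithmic mean also has integral \<open>m\<close>, and truncation only increases it.\<close>
    have "m \<le> (\<integral>x. ?g n x \<partial>M)" if n: "n > 0" for n
    proof -
      have integrable_c: "integrable M (\<lambda>x. indicator E x * ?c x k)" for k
        by (rule bounded_integrable, simp) (rule orbit)
      have "(\<integral>x. indicator E x * ?c x k \<partial>M) = m" for k
      proof -
        have "(\<integral>x. indicator E x * ?c x k \<partial>M) = (\<integral>x. indicator E ((T ^^ k) x) * ?c x k \<partial>M)"
          by (rule Bochner_Integration.integral_cong) (simp_all add: indE)
        also have "\<dots> = m"
          unfolding m_def by (rule integral_compose_funpow[of "\<lambda>x. indicator E x * f x"]) simp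
        finally show ?thesis .
      qed
      then have "(\<Sum>k=1..n. 1 / real k * (\<integral>x. indicator E x * ?c x (k - 1) \<partial>M)) = harm n * m"
        by (simp add: harm_def sum_distrib_right inverse_eq_divide)
      then have "m = 1 / harm n * (\<Sum>k=1..n. 1 / real k * (\<integral>x. indicator E x * ?c x (k - 1) \<partial>M))"
        using less_imp_neq[OF harm_pos[OF n, where ?'a=real]] by simp
      also have "\<dots> = (\<integral>x. 1 / harm n * (\<Sum>k=1..n. 1 / real k * (indicator E x * ?c x (k - 1))) \<partial>M)"
        using integrable_c by (subst integral_mult_right_zero)
          (subst Bochner_Integration.integral_sum, simp_all)
      also have "\<dots> = (\<integral>x. indicator E x * log_mean (?c x) n \<partial>M)"
        by (rule Bochner_Integration.integral_cong) (simp_all add: log_mean_def indicator_def)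
      also have "\<dots> \<le> (\<integral>x. ?g n x \<partial>M)"
      proof (rule integral_mono)
        show "integrable M (\<lambda>x. indicator E x * log_mean (?c x) n)"
          by (rule bounded_integrable, simp) (rule log_bound)
        show "integrable M (?g n)"
        proof (rule bounded_integrable)
          show "\<bar>max a (log_mean (?c x) n)\<bar> \<le> \<bar>a\<bar> + B" if "x \<in> space M" for x
            using log_bound[OF that, of n] by linarith
        qed simp
      qed (simp add: indicator_def)
      finally show ?thesis .
    qed
    then show ?thesis
      by (intro LIMSEQ_le_const[OF lim]) (auto intro!: exI[of _ 1])
  qed
  have "(b - a) * prob E \<le> 0" using lower upper by (simp add: algebra_simps)
  with ab have "prob E = 0"
    by (smt (verit) measure_nonneg zero_less_mult_iff)
  then show ?thesis using E by (simp add: null_sets_def emeasure_eq_measure)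
qed

text \<open>A violation leaves room for two rationals \<open>a < b\<close> strictly between the two
  upper means. Countably many such pairs exist, each with a null exceptional set.\<close>

lemma AE_upper_cesaro_mean_le_upper_log_mean:
  fixes f :: "'a \<Rightarrow> real"
  assumes [measurable]: "f \<in> borel_measurable M"
    and B: "\<And>x. x \<in> space M \<Longrightarrow> \<bar>f x\<bar> \<le> B"
  shows "AE x in M. limsup (\<lambda>n. ereal (cesaro_mean (\<lambda>k. f ((T ^^ k) x)) n))
    \<le> limsup (\<lambda>n. ereal (log_mean (\<lambda>k. f ((T ^^ k) x)) n))"
proof -
  let ?u = "\<lambda>x. limsup (\<lambda>n. ereal (cesaro_mean (\<lambda>k. f ((T ^^ k) x)) n))"
  let ?v = "\<lambda>x. limsup (\<lambda>n. ereal (log_mean (\<lambda>k. f ((T ^^ k) x)) n))"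
  have "AE x in M. \<not> (?v x < ereal (real_of_rat a) \<and> ereal (real_of_rat b) < ?u x)"
    if "a < b" for a b
  proof -
    have "{x \<in> space M. ?v x < ereal (real_of_rat a) \<and> ereal (real_of_rat b) < ?u x} \<in> null_sets M"
      using that by (intro null_upper_log_mean_less[OF _ B]) (simp_all add: of_rat_less)
    from AE_not_in[OF this] show ?thesis by (rule AE_mp) (rule AE_I2, simp)
  qed
  then have "AE x in M. \<forall>a b. a < b \<longrightarrow>
      \<not> (?v x < ereal (real_of_rat a) \<and> ereal (real_of_rat b) < ?u x)"
    unfolding AE_all_countable by (intro allI) (case_tac "a < b", simp_all)
  then show ?thesis
  proof (rule AE_mp, intro AE_I2 impI)
    fix x assume *: "\<forall>a b. a < b \<longrightarrow>
      \<not> (?v x < ereal (real_of_rat a) \<and> ereal (real_of_rat b) < ?u x)"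
    show "?u x \<le> ?v x"
    proof (rule ccontr)
      assume "\<not> ?u x \<le> ?v x"
      then obtain a where a: "?v x < ereal (real_of_rat a)" "ereal (real_of_rat a) < ?u x"
        using ereal_dense3[of "?v x" "?u x"] unfolding not_le by blast
      then obtain b where b: "ereal (real_of_rat a) < ereal (real_of_rat b)" "ereal (real_of_rat b) < ?u x"
        using ereal_dense3[of "ereal (real_of_rat a)" "?u x"] by blast
      with a * show False by (auto simp: of_rat_less)
    qed
  qed
qed

end

section \<open>Mean orbit distances\<close>

lemma mean_orbit_dist_altdef:
  "mean_orbit_dist T x y = limsup (\<lambda>n. ereal (cesaro_mean (\<lambda>k. dist ((T ^^ k) x) ((T ^^ k) y)) n))"
  by (simp add: mean_orbit_dist_def cesaro_mean_def)

lemma log_mean_orbit_dist_altdef: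
  "log_mean_orbit_dist T x y = limsup (\<lambda>n. ereal (log_mean (\<lambda>k. dist ((T ^^ k) x) ((T ^^ k) y)) n))"
  by (simp add: log_mean_orbit_dist_def log_mean_def)

lemma log_mean_orbit_dist_le: "log_mean_orbit_dist T x y \<le> mean_orbit_dist T x y"
  unfolding mean_orbit_dist_altdef log_mean_orbit_dist_altdef
  by (rule limsup_log_mean_le_limsup_cesaro_mean)

lemma mean_orbit_dist_triangle_le:
  assumes "mean_orbit_dist T x z < ereal \<epsilon>" "mean_orbit_dist T y z < ereal \<epsilon>'"
  shows "mean_orbit_dist T x y \<le> ereal (\<epsilon> + \<epsilon>')"
  using assms unfolding mean_orbit_dist_altdef
  by (rule limsup_cesaro_mean_le_add) (rule dist_triangle2)

section \<open>Separability of compact sets and its measure-theoretic consequences\<close>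

lemma compact_countable_dense:
  fixes X :: "'a::metric_space set"
  assumes "compact X"
  obtains D where "countable D" "\<And>x e. x \<in> X \<Longrightarrow> 0 < e \<Longrightarrow> \<exists>q\<in>D. dist q x < e"
proof -
  \<comment> \<open>Total boundedness yields finite nets at every scale \<open>1 / (n + 1)\<close>;
    their centres may lie outside \<open>X\<close>.\<close>
  have "\<forall>n. \<exists>k. finite k \<and> X \<subseteq> (\<Union>x\<in>k. ball x (1 / real (Suc n)))"
    using assms unfolding compact_eq_totally_bounded by auto
  then obtain k where k: "\<And>n. finite (k n)" "\<And>n. X \<subseteq> (\<Union>x\<in>k n. ball x (1 / real (Suc n)))"
    by metis
  show ?thesis
  proof
    show "countable (\<Union>n. k n)" using k(1) by (auto intro: countable_finite)
    fix x and e :: real assume "x \<in> X" "0 < e"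
    then obtain n where n: "1 / real (Suc n) < e" using nat_approx_posE by blast
    from \<open>x \<in> X\<close> k(2)[of n] obtain q where "q \<in> k n" "dist q x < 1 / real (Suc n)" by auto
    with n show "\<exists>q\<in>\<Union>n. k n. dist q x < e" by force
  qed
qed

text \<open>The ambient type need not be second countable, so the Borel structure of the product is
  only accessible through a countable set that is dense near \<open>X\<close>.\<close>

lemma borel_measurable_dist_compact:
  fixes M :: "'a::metric_space measure"
  assumes "compact X" and sets: "sets M = sets (restrict_space borel X)"
  shows "(\<lambda>(x, y). dist x y) \<in> borel_measurable (M \<Otimes>\<^sub>M M)"
proof -
  obtain D where D: "countable D" "\<And>x e. x \<in> X \<Longrightarrow> 0 < e \<Longrightarrow> \<exists>q\<in>D. dist q x < e"
    using compact_countable_dense[OF assms(1)] by metis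
  have space: "space M = X" using sets_eq_imp_space_eq[OF sets] by (simp add: space_restrict_space)
  have "(\<lambda>x. dist x q) \<in> borel_measurable (restrict_space borel X)" for q
    by (intro borel_measurable_continuous_on_restrict continuous_intros)
  then have [measurable]: "(\<lambda>x. dist x q) \<in> borel_measurable M" for q
    by (simp add: measurable_cong_sets[OF sets refl])
  show ?thesis
  proof (rule borel_measurableI_less)
    fix a :: real
    \<comment> \<open>By the triangle inequality, the condition on the distance becomes a countable
      union of conditions on distances to fixed points.\<close>
    have "{p \<in> space (M \<Otimes>\<^sub>M M). (case p of (x, y) \<Rightarrow> dist x y) < a}
      = (\<Union>q\<in>D. {p \<in> space (M \<Otimes>\<^sub>M M). dist (fst p) q + dist (snd p) q < a})" (is "?L = ?R")
    proof (intro equalityI subsetI)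
      fix p assume p: "p \<in> ?L"
      then have "fst p \<in> X" "dist (fst p) (snd p) < a"
        by (auto simp: space_pair_measure space)
      \<comment> \<open>Half of the gap suffices because the distance from \<open>q\<close> to
        \<open>fst p\<close> enters twice.\<close>
      then obtain q where q: "q \<in> D" "dist q (fst p) < (a - dist (fst p) (snd p)) / 2"
        using D(2)[of "fst p" "(a - dist (fst p) (snd p)) / 2"] by auto
      have "dist (snd p) q \<le> dist (fst p) (snd p) + dist q (fst p)"
        by (metis add.commute dist_commute dist_triangle)
      with q have "dist (fst p) q + dist (snd p) q < a"
        by (simp add: dist_commute field_simps)
      with p q show "p \<in> ?R" by auto
    next
      fix p assume "p \<in> ?R"
      then show "p \<in> ?L"
        by (auto simp: case_prod_beta intro: le_less_trans[OF dist_triangle2])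
    qed
    also have "\<dots> \<in> sets (M \<Otimes>\<^sub>M M)"
      using D(1) by (intro sets.countable_UN') auto
    finally show "{p \<in> space (M \<Otimes>\<^sub>M M). (case p of (x, y) \<Rightarrow> dist x y) < a} \<in> sets (M \<Otimes>\<^sub>M M)" .
  qed
qed

lemma ball_Int_sets:
  assumes "sets M = sets (restrict_space borel X)" "Y \<in> sets M"
  shows "Y \<inter> ball q r \<in> sets M"
proof -
  obtain A where "A \<in> sets borel" "Y = X \<inter> A"
    using assms by (auto simp: sets_restrict_space)
  then have "Y \<inter> ball q r = X \<inter> (A \<inter> ball q r)" "A \<inter> ball q r \<in> sets borel"
    by (auto intro: sets.Int)
  then show ?thesis
    unfolding assms(1) sets_restrict_space by blast
qed

text \<open>What remains of \<open>Y\<close> lies in the support of the measure restricted to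
  \<open>Y\<close>. Only countably many balls with centres in a dense set and radii
  \<open>1 / (n + 1)\<close> have to be removed.\<close>

lemma exists_null_set_of_negligible_balls:
  fixes M :: "'a::metric_space measure"
  assumes "compact X" and sets: "sets M = sets (restrict_space borel X)" and Y: "Y \<in> sets M"
  obtains N where "N \<in> null_sets M"
    "\<And>x r. x \<in> Y - N \<Longrightarrow> 0 < r \<Longrightarrow> Y \<inter> ball x r \<notin> null_sets M"
proof -
  obtain D where D: "countable D" "\<And>x e. x \<in> X \<Longrightarrow> 0 < e \<Longrightarrow> \<exists>q\<in>D. dist q x < e"
    using compact_countable_dense[OF assms(1)] by metis
  have space: "space M = X" using sets_eq_imp_space_eq[OF sets] by (simp add: space_restrict_space)
  define I where "I = {(q, n :: nat) \<in> D \<times> UNIV. Y \<inter> ball q (1 / real (Suc n)) \<in> null_sets M}"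
  define N where "N = (\<Union>(q, n)\<in>I. Y \<inter> ball q (1 / real (Suc n)))"
  have "countable I"
    by (rule countable_subset[of _ "D \<times> UNIV"]) (use D(1) in \<open>auto simp: I_def\<close>)
  then have "N \<in> null_sets M"
    unfolding N_def by (rule null_sets_UN') (auto simp: I_def)
  moreover have "Y \<inter> ball x r \<notin> null_sets M" if x: "x \<in> Y - N" and r: "0 < r" for x r
  proof
    assume null: "Y \<inter> ball x r \<in> null_sets M"
    have "x \<in> X" using x sets.sets_into_space[OF Y] space by auto
    \<comment> \<open>With radius below \<open>r / 2\<close>, a ball around \<open>q\<close> that
      contains \<open>x\<close> lies inside \<open>ball x r\<close>.\<close>
    obtain n where n: "1 / real (Suc n) < r / 2" using nat_approx_posE[of "r / 2"] r by auto
    obtain q where q: "q \<in> D" "dist q x < 1 / real (Suc n)"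
      using D(2)[OF \<open>x \<in> X\<close>, of "1 / real (Suc n)"] by auto
    have "ball q (1 / real (Suc n)) \<subseteq> ball x r"
    proof
      fix z assume z: "z \<in> ball q (1 / real (Suc n))"
      have "dist x z \<le> dist q x + dist q z" by (metis dist_commute dist_triangle)
      with z q n show "z \<in> ball x r" by simp
    qed
    then have "Y \<inter> ball q (1 / real (Suc n)) \<in> null_sets M"
      using null by (intro null_sets_subset[OF null ball_Int_sets[OF sets Y]]) auto
    then have "x \<in> N" using q x by (force simp: N_def I_def)
    with x show False by blast
  qed
  ultimately show ?thesis by (rule that)
qed

text \<open>The map \<open>T \<times> T\<close> preserves the product measure, so the comparison of
  upper means applies to the distance function there. Fubini turns the result for almost every pair
  into the iterated form.\<close>

lemma AE_mean_orbit_dist_le_log_mean_orbit_dist: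
  assumes tds: "topological_dynamical_system X T"
    and inv: "invariant_borel_probability X T \<mu>"
  shows "AE x in \<mu>. AE y in \<mu>. mean_orbit_dist T x y \<le> log_mean_orbit_dist T x y"
proof -
  interpret prob_space \<mu> using inv by (simp add: invariant_borel_probability_def)
  interpret pair: pair_prob_space \<mu> \<mu> ..
  have X: "compact X" and T: "continuous_on X T" "T \<in> X \<rightarrow> X"
    using tds by (auto simp: topological_dynamical_system_def)
  have sets: "sets \<mu> = sets (restrict_space borel X)"
    using inv by (simp add: invariant_borel_probability_def)
  have space: "space \<mu> = X" using sets_eq_imp_space_eq[OF sets] by (simp add: space_restrict_space)
  have "T \<in> measurable (restrict_space borel X) (restrict_space borel X)"
    using T by (intro measurable_restrict_space2 borel_measurable_continuous_on_restrict)
      (auto simp: space_restrict_space)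
  then have meas [measurable]: "T \<in> measurable \<mu> \<mu>"
    by (simp add: measurable_cong_sets[OF sets sets])
  have distr: "distr \<mu> \<mu> T = \<mu>"
    using inv by (intro measure_eqI)
      (simp_all add: emeasure_distr space invariant_borel_probability_def)
  define S where "S = (\<lambda>(x, y). (T x, T y))"
  have S_funpow: "(S ^^ k) (x, y) = ((T ^^ k) x, (T ^^ k) y)" for k x y
    by (induction k) (auto simp: S_def)
  interpret S: measure_preserving "\<mu> \<Otimes>\<^sub>M \<mu>" S
  proof
    show "S \<in> measurable (\<mu> \<Otimes>\<^sub>M \<mu>) (\<mu> \<Otimes>\<^sub>M \<mu>)" unfolding S_def by measurable
    have "distr \<mu> \<mu> T \<Otimes>\<^sub>M distr \<mu> \<mu> T = distr (\<mu> \<Otimes>\<^sub>M \<mu>) (\<mu> \<Otimes>\<^sub>M \<mu>) S"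
      unfolding S_def
      by (rule pair_measure_distr) (simp_all add: distr sigma_finite_measure_axioms)
    then show "distr (\<mu> \<Otimes>\<^sub>M \<mu>) (\<mu> \<Otimes>\<^sub>M \<mu>) S = \<mu> \<Otimes>\<^sub>M \<mu>" by (simp add: distr)
  qed
  obtain B where B: "\<And>x y. x \<in> X \<Longrightarrow> y \<in> X \<Longrightarrow> dist x y \<le> B"
    using compact_imp_bounded[OF X] unfolding bounded_two_points by auto
  have "AE p in \<mu> \<Otimes>\<^sub>M \<mu>.
      limsup (\<lambda>n. ereal (cesaro_mean (\<lambda>k. (case (S ^^ k) p of (x, y) \<Rightarrow> dist x y)) n))
    \<le> limsup (\<lambda>n. ereal (log_mean (\<lambda>k. (case (S ^^ k) p of (x, y) \<Rightarrow> dist x y)) n))"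
    by (rule S.AE_upper_cesaro_mean_le_upper_log_mean
        [OF borel_measurable_dist_compact[OF X sets], where B = B])
      (auto simp: space_pair_measure space B)
  then show ?thesis
    by (auto dest!: pair.AE_pair simp: S_funpow mean_orbit_dist_altdef log_mean_orbit_dist_altdef)
qed

section \<open>The two implications\<close>

lemma mean_equicontinuous_imp_log_mean_equicontinuous:
  assumes "mean_equicontinuous_wrt \<mu> T"
  shows "log_mean_equicontinuous_wrt \<mu> T"
  using assms unfolding mean_equicontinuous_wrt_def log_mean_equicontinuous_wrt_def
  by (meson le_less_trans log_mean_orbit_dist_le)

text \<open>A given pair \<open>(x, y)\<close> may be exceptional for the comparison, but
  \<open>(x, z)\<close> and \<open>(y, z)\<close> are generic for almost every \<open>z\<close>, and
  a set of positive measure near \<open>x\<close> supplies such a \<open>z\<close> in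
  \<open>Y\<close>.\<close>

lemma log_mean_equicontinuous_imp_mean_equicontinuous:
  assumes tds: "topological_dynamical_system X T"
    and inv: "invariant_borel_probability X T \<mu>"
    and log: "log_mean_equicontinuous_wrt \<mu> T"
  shows "mean_equicontinuous_wrt \<mu> T"
  unfolding mean_equicontinuous_wrt_def
proof
  fix \<eta> :: real assume "\<eta> \<in> {0<..<1}"
  with log obtain Y where Y [measurable]: "Y \<in> sets \<mu>" and "measure \<mu> Y > \<eta>"
    and equi: "\<And>\<epsilon>::real. \<epsilon> > 0 \<Longrightarrow> \<exists>\<delta>>0. \<forall>x\<in>Y. \<forall>y\<in>Y. dist x y < \<delta> \<longrightarrow> log_mean_orbit_dist T x y < ereal \<epsilon>"
    unfolding log_mean_equicontinuous_wrt_def by meson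
  have X: "compact X" using tds by (simp add: topological_dynamical_system_def)
  have sets: "sets \<mu> = sets (restrict_space borel X)"
    using inv by (simp add: invariant_borel_probability_def)
  obtain N where N: "N \<in> null_sets \<mu>"
    "\<And>x r. x \<in> Y - N \<Longrightarrow> 0 < r \<Longrightarrow> Y \<inter> ball x r \<notin> null_sets \<mu>"
    using exists_null_set_of_negligible_balls[OF X sets Y] by metis
  let ?good = "\<lambda>x. AE y in \<mu>. mean_orbit_dist T x y \<le> log_mean_orbit_dist T x y"
  obtain N' where N': "N' \<in> null_sets \<mu>" "{x \<in> space \<mu>. \<not> ?good x} \<subseteq> N'"
    using AE_mean_orbit_dist_le_log_mean_orbit_dist[OF tds inv] unfolding eventually_ae_filter by auto
  \<comment> \<open>Outside \<open>N\<close> every ball meets \<open>Y\<close> in positive measure;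
    outside \<open>N'\<close> the comparison holds with almost every partner.\<close>
  define Z where "Z = Y - (N \<union> N')"
  have NN': "N \<union> N' \<in> null_sets \<mu>" using N(1) N'(1) by auto
  have "Z \<in> sets \<mu>" unfolding Z_def using Y NN' by auto
  moreover have "measure \<mu> Z > \<eta>"
    unfolding Z_def using \<open>measure \<mu> Y > \<eta>\<close> measure_Diff_null_set[OF Y NN'] by simp
  moreover have "\<exists>\<delta>>0. \<forall>x\<in>Z. \<forall>y\<in>Z. dist x y < \<delta> \<longrightarrow> mean_orbit_dist T x y < ereal \<epsilon>"
    if "\<epsilon> > 0" for \<epsilon> :: real
  proof -
    \<comment> \<open>Two comparisons with \<open>z\<close> add up to two thirds of \<epsilon>,
      which restores strictness after the non-strict triangle bound.\<close>
    from equi[of "\<epsilon> / 3"] that obtain \<delta> where "\<delta> > 0"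
      and \<delta>: "\<And>x y. x \<in> Y \<Longrightarrow> y \<in> Y \<Longrightarrow> dist x y < \<delta> \<Longrightarrow> log_mean_orbit_dist T x y < ereal (\<epsilon> / 3)"
      by auto
    \<comment> \<open>Halving \<delta> keeps \<open>y\<close> within \<delta> of any
      \<open>z\<close> in \<open>ball x (\<delta> / 2)\<close>.\<close>
    have "mean_orbit_dist T x y < ereal \<epsilon>" if xy: "x \<in> Z" "y \<in> Z" "dist x y < \<delta> / 2" for x y
    proof -
      have in_Y: "x \<in> Y" "y \<in> Y" using xy by (auto simp: Z_def)
      have "?good x" "?good y"
        using xy N'(2) sets.sets_into_space[OF Y] by (auto simp: Z_def)
      then have AE: "AE z in \<mu>. mean_orbit_dist T x z \<le> log_mean_orbit_dist T x z
          \<and> mean_orbit_dist T y z \<le> log_mean_orbit_dist T y z" by simp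
      have "\<exists>z. z \<in> Y \<inter> ball x (\<delta> / 2) \<and> mean_orbit_dist T x z \<le> log_mean_orbit_dist T x z
          \<and> mean_orbit_dist T y z \<le> log_mean_orbit_dist T y z"
      proof (rule ccontr)
        assume *: "\<not> ?thesis"
        have "AE z in \<mu>. z \<notin> Y \<inter> ball x (\<delta> / 2)"
          using AE by (rule AE_mp) (use * in \<open>auto intro!: AE_I2\<close>)
        then have "Y \<inter> ball x (\<delta> / 2) \<in> null_sets \<mu>"
          using AE_iff_null_sets[OF ball_Int_sets[OF sets Y, of x "\<delta> / 2"]] by simp
        with N(2)[of x "\<delta> / 2"] xy \<open>\<delta> > 0\<close> show False by (auto simp: Z_def)
      qed
      then obtain z where z: "z \<in> Y" "dist x z < \<delta> / 2"
        "mean_orbit_dist T x z \<le> log_mean_orbit_dist T x z"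
        "mean_orbit_dist T y z \<le> log_mean_orbit_dist T y z" by auto
      have "dist y z < \<delta>" using z(2) xy(3) dist_triangle[of y z x] by (simp add: dist_commute)
      then have "log_mean_orbit_dist T x z < ereal (\<epsilon> / 3)" "log_mean_orbit_dist T y z < ereal (\<epsilon> / 3)"
        using \<delta> in_Y z \<open>\<delta> > 0\<close> by auto
      then have "mean_orbit_dist T x y \<le> ereal (\<epsilon> / 3 + \<epsilon> / 3)"
        using z by (intro mean_orbit_dist_triangle_le[of _ _ z]) auto
      also have "\<dots> < ereal \<epsilon>" using \<open>\<epsilon> > 0\<close> by simp
      finally show ?thesis .
    qed
    then show ?thesis using \<open>\<delta> > 0\<close> by (intro exI[of _ "\<delta> / 2"]) auto
  qed
  ultimately show "\<exists>Y\<in>sets \<mu>. measure \<mu> Y > \<eta> \<and>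
     (\<forall>\<epsilon>>0::real. \<exists>\<delta>>0. \<forall>x\<in>Y. \<forall>y\<in>Y. dist x y < \<delta> \<longrightarrow> mean_orbit_dist T x y < ereal \<epsilon>)"
    by blast
qed

theorem theorem4p6:
  fixes X :: "'a::metric_space set" and T :: "'a \<Rightarrow> 'a" and \<mu> :: "'a measure"
  assumes "topological_dynamical_system X T"
    and "ergodic_borel_probability X T \<mu>"
  shows "mean_equicontinuous_wrt \<mu> T \<longleftrightarrow> log_mean_equicontinuous_wrt \<mu> T"
proof
  assume "mean_equicontinuous_wrt \<mu> T"
  then show "log_mean_equicontinuous_wrt \<mu> T"
    by (rule mean_equicontinuous_imp_log_mean_equicontinuous)
next
  assume "log_mean_equicontinuous_wrt \<mu> T"
  moreover have "invariant_borel_probability X T \<mu>"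
    using assms(2) by (simp add: ergodic_borel_probability_def)
  ultimately show "mean_equicontinuous_wrt \<mu> T"
    using assms(1) log_mean_equicontinuous_imp_mean_equicontinuous by metis
qed

end
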